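(* Let $k\ge 1$ be an integer and let $\mathcal{D}_k$ denote the set of Dyck paths of length $2k$. For $p\in\mathcal{D}_k$ and $0\le i\le k$, let $V_i(p)$ be the number of vertices of $p$ at altitude $i$, and let $\vec V(p)=(V_0(p),\dots,V_k(p))$. Let $E$ denote expectation with respect to the uniform distribution on $\mathcal{D}_k$. Then \[ \| E[\vec{V}]\|_2^2 \;=\; \frac{1}{C_k^2}\sum_{p_1,p_2\in\mathcal{D}_k}\sum_{i=0}^{k} V_i(p_1)V_i(p_2) \;=\; \frac{C_{2k+1}}{C_k^2}, \] where $C_m=\frac{1}{m+1}\binom{2m}{m}$ is the $m$-th Catalan number.
   Context: A Dyck path of length $2k$ is a lattice path made of $2k$ steps, each either a rise $(1,1)$ or a fall $(1,-1)$, starting at $(0,0)$, ending at $(2k,0)$, and never going below the $x$-axis. Its vertices are the $2k+1$ lattice points $(j,y_j)$, $j=0,\dots,2k$, visited by the path; the altitude of a vertex is its $y$-coordinate. $|\mathcal{D}_k|=C_k$. *)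

theory Defs
  imports "HOL-Probability.Probability"
begin

definition catalan :: "nat \<Rightarrow> real" where
  "catalan m = 1 / (real m + 1) * real ((2 * m) choose m)"

definition rise :: "int \<times> int" where "rise = (1, 1)"

definition fall :: "int \<times> int" where "fall = (1, -1)"

(* A lattice path starting at the origin is given by the list of its steps;
   its j-th vertex is the (componentwise) sum of the first j steps. *)
definition path_vertex :: "(int \<times> int) list \<Rightarrow> nat \<Rightarrow> int \<times> int" where
  "path_vertex p j = sum_list (take j p)"

definition path_vertices :: "(int \<times> int) list \<Rightarrow> (int \<times> int) set" where
  "path_vertices p = {path_vertex p j | j. j \<le> length p}"

definition dyck_paths :: "nat \<Rightarrow> (int \<times> int) list set" where
  "dyck_paths k = {p. length p = 2 * k \<and> set p \<subseteq> {rise, fall} \<and>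
     path_vertex p (2 * k) = (2 * int k, 0) \<and>
     (\<forall>v \<in> path_vertices p. snd v \<ge> 0)}"

definition vertex_count :: "nat \<Rightarrow> (int \<times> int) list \<Rightarrow> nat" where
  "vertex_count i p = card {v \<in> path_vertices p. snd v = int i}"

(* Coordinate i of the expectation (taken coordinatewise) of the random vector
   (V_0, ..., V_k); only the coordinates i = 0, ..., k are meant. *)
definition expected_vertex_count :: "nat \<Rightarrow> nat \<Rightarrow> real" where
  "expected_vertex_count k i =
     measure_pmf.expectation (pmf_of_set (dyck_paths k)) (\<lambda>p. real (vertex_count i p))"

(* pmf_of_set is the uniform distribution only on finite nonempty sets. *)
lemma finite_dyck_paths: "finite (dyck_paths k)"
proof (rule finite_subset)
  show "dyck_paths k \<subseteq> {p. set p \<subseteq> {rise, fall} \<and> length p = 2 * k}"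
    by (auto simp: dyck_paths_def)
qed (rule finite_lists_length_eq, simp)

lemma dyck_paths_nonempty: "dyck_paths k \<noteq> {}"
proof -
  have sum_rise: "sum_list (replicate n rise) = (int n, int n)" for n
    by (induction n) (auto simp: rise_def zero_prod_def)
  have sum_fall: "sum_list (replicate n fall) = (int n, - int n)" for n
    by (induction n) (auto simp: fall_def zero_prod_def)
  have "replicate k rise @ replicate k fall \<in> dyck_paths k"
    by (auto simp: dyck_paths_def path_vertices_def path_vertex_def sum_rise sum_fall)
  then show ?thesis by blast
qed

end

theory Submission
  imports Defs
begin

text \<open>
  Summing over all Dyck paths, the number of vertices at altitude \<open>i\<close> is
  \<open>\<Sum>j\<le>2k. N j i * N (2k - j) i\<close>, where \<open>N n h\<close> counts the nonnegative paths of length \<open>n\<close>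
  from altitude \<open>0\<close> to \<open>h\<close>: cut at the vertex. Inserting a rise at the cut, which becomes
  the last rise leaving altitude \<open>i\<close>, turns this into the number \<open>N (2k+1) (2i+1)\<close> of nonnegative
  paths of odd length. The squares of these numbers count the Dyck paths of length \<open>4k+2\<close> according
  to the altitude of the midpoint, so they add up to \<open>C\<^bsub>2k+1\<^esub>\<close>.
\<close>

section \<open>Nonnegative walks\<close>

text \<open>\<open>walks n 0 h\<close> is the \<open>N n h\<close> above. The bare first-step
  recursion lets the counting identities be proved by induction instead of bijections;
  \<open>card_nonneg_paths\<close> ties it to actual paths.\<close>

fun walks :: "nat \<Rightarrow> nat \<Rightarrow> nat \<Rightarrow> nat" where
  "walks 0 a b = (if a = b then 1 else 0)"
| "walks (Suc n) 0 b = walks n 1 b"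
| "walks (Suc n) (Suc a) b = walks n a b + walks n (a + 2) b"

lemma walks_last_step_0: "walks (Suc n) a 0 = walks n a 1"
proof (induction n arbitrary: a)
  case 0
  then show ?case by (cases a) auto
next
  case (Suc n)
  then show ?case by (cases a) (simp_all only: walks.simps(2,3))
qed

lemma walks_last_step_Suc: "walks (Suc n) a (Suc b) = walks n a b + walks n a (b + 2)"
proof (induction n arbitrary: a)
  case 0
  then show ?case by (cases a) auto
next
  case (Suc n)
  then show ?case by (cases a) (simp_all only: walks.simps(2,3) add_ac)
qed

text \<open>Reversal of walks: splitting off the first step on one side matches splitting off the
  last step on the other.\<close>

lemma walks_commute: "walks n a b = walks n b a"
proof (induction n arbitrary: a b)
  case (Suc n)
  then show ?case
    by (cases a) (simp_all only: walks.simps(2,3) walks_last_step_0 walks_last_step_Suc)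
qed auto

lemma walks_eq_0_parity: "odd (n + a + b) \<Longrightarrow> walks n a b = 0"
  by (induction n a b rule: walks.induct) auto

lemma walks_eq_0_height: "n + a < b \<Longrightarrow> walks n a b = 0"
  by (induction n a b rule: walks.induct) auto

text \<open>Cut after \<open>m\<close> steps, where the altitude is at most \<open>m + a\<close>.
  Any larger cutoff \<open>H\<close> is allowed so that one \<open>H\<close> serves both branches of
  the recursion.\<close>

lemma sum_walks_mult:
  "m + a \<le> H \<Longrightarrow> (\<Sum>h\<le>H. walks m a h * walks n h b) = walks (m + n) a b"
proof (induction m a H rule: walks.induct)
  case (1 a H)
  have "(\<Sum>h\<le>H. walks 0 a h * walks n h b) = (\<Sum>h\<le>H. if a = h then walks n h b else 0)"
    by (intro sum.cong) auto
  with 1 show ?case by simp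
qed (auto simp: algebra_simps sum.distrib)

text \<open>Decomposition of a walk to altitude \<open>a + b + 1\<close> at its last rise leaving altitude \<open>a\<close>.\<close>

lemma walks_convolution:
  "(\<Sum>j\<le>n. walks j a 0 * walks (n - j) b 0) = walks (Suc n) (a + b + 1) 0"
proof (induction n arbitrary: b)
  case 0
  then show ?case by auto
next
  case (Suc n)
  have "(\<Sum>j\<le>Suc n. walks j a 0 * walks (Suc n - j) b 0) =
      (\<Sum>j\<le>n. walks j a 0 * walks (Suc (n - j)) b 0) + walks (Suc n) a 0 * walks 0 b 0"
    by (simp add: Suc_diff_le)
  also have "\<dots> = walks (Suc (Suc n)) (a + b + 1) 0"
  \<comment> \<open>The split-off term is the fall branch of the right-hand side if
    \<open>b = 0\<close>, and vanishes otherwise.\<close>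
  proof (cases b)
    case 0
    then show ?thesis
      using Suc.IH[of 1] by (simp only: walks.simps add.commute) simp
  next
    case (Suc c)
    then show ?thesis
      using Suc.IH[of c] Suc.IH[of "c + 2"]
      by (simp add: algebra_simps sum.distrib del: walks.simps(2))
  qed
  finally show ?case .
qed

lemma sum_walks_odd_squared:
  "(\<Sum>i\<le>k. (walks (2 * k + 1) (2 * i + 1) 0)\<^sup>2) = walks (4 * k + 2) 0 0"
proof -
  let ?f = "\<lambda>h. walks (2 * k + 1) 0 h * walks (2 * k + 1) h 0"
  have "(\<Sum>i\<le>k. (walks (2 * k + 1) (2 * i + 1) 0)\<^sup>2) = (\<Sum>i\<le>k. ?f (2 * i + 1))"
    by (intro sum.cong refl) (subst (2) walks_commute, simp only: power2_eq_square)
  also have "\<dots> = sum ?f ((\<lambda>i. 2 * i + 1) ` {..k})"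
    by (subst sum.reindex) (auto simp: inj_on_def)
  also have "\<dots> = sum ?f {..2 * k + 1}"
  \<comment> \<open>An odd number of steps from altitude 0 ends at an odd altitude, so even
    \<open>h\<close> contribute nothing.\<close>
  proof (rule sum.mono_neutral_left)
    show "\<forall>h\<in>{..2 * k + 1} - (\<lambda>i. 2 * i + 1) ` {..k}. ?f h = 0"
    proof
      fix h assume h: "h \<in> {..2 * k + 1} - (\<lambda>i. 2 * i + 1) ` {..k}"
      have "even h"
      proof (rule ccontr)
        assume "odd h"
        then obtain i where "h = 2 * i + 1" by (elim oddE)
        with h show False by auto
      qed
      then show "?f h = 0" by (simp add: walks_eq_0_parity del: walks.simps)
    qed
  qed auto
  also have "\<dots> = walks (4 * k + 2) 0 0"
    by (subst sum_walks_mult) (auto simp del: walks.simps)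
  finally show ?thesis .
qed

section \<open>Ballot numbers and Catalan numbers\<close>

lemma walks_down: "walks h h 0 = 1"
proof (induction h)
  case (Suc h)
  have "walks h (h + 2) 0 = 0"
    using walks_commute[of h "h + 2" 0] walks_eq_0_height[of h 0 "h + 2"] by simp
  with Suc show ?case by simp
qed simp

text \<open>The reflection principle, written additively to avoid truncated subtraction. With
  \<open>n = 2 * r + h + 2\<close>, a walk from \<open>h\<close> to 0 has \<open>r + 1\<close>
  rises; those touching -1 reflect to walks from \<open>h\<close> to -2, which have \<open>r\<close>
  rises. The induction is on length: a first fall lowers \<open>h\<close> by 1, a first rise lowers
  \<open>r\<close> by 1 and raises \<open>h\<close> by 1.\<close>

lemma walks_reflection:
  "walks (2 * r + h + 2) h 0 + (2 * r + h + 2 choose r) = (2 * r + h + 2 choose Suc r)"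
proof (induction "2 * r + h" arbitrary: r h rule: less_induct)
  case less
  show ?case
  proof (cases h)
    case h: 0
    show ?thesis
    proof (cases r)
      case 0
      with h show ?thesis by (simp add: numeral_2_eq_2)
    next
      case (Suc s)
      have "walks (2 * s + 1 + 2) 1 0 + (2 * s + 1 + 2 choose s) = (2 * s + 1 + 2 choose Suc s)"
        using h Suc by (intro less) simp
      \<comment> \<open>The two middle entries of an odd row agree; this makes up for the missing
        fall at altitude 0.\<close>
      moreover have "(2 * s + 1 + 2 choose Suc s) = (2 * s + 1 + 2 choose Suc (Suc s))"
        by (subst binomial_symmetric) auto
      moreover have "walks (2 * r + h + 2) h 0 = walks (2 * s + 1 + 2) 1 0"
        using h Suc by (simp add: eval_nat_numeral)
      moreover have e: "2 * r + h + 2 = Suc (2 * s + 1 + 2)"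
        using h Suc by simp
      ultimately show ?thesis
        unfolding e Suc binomial_Suc_Suc by simp
    qed
  next
    case h: (Suc g)
    have IH1: "walks (2 * r + g + 2) g 0 + (2 * r + g + 2 choose r) = (2 * r + g + 2 choose Suc r)"
      using h by (intro less) simp
    have e: "2 * r + h + 2 = Suc (2 * r + g + 2)"
      using h by simp
    show ?thesis
    proof (cases r)
      \<comment> \<open>After a first rise only falls remain, which the induction hypothesis does
        not cover.\<close>
      case 0
      then show ?thesis
        using IH1 walks_down[of "g + 2"] unfolding e h walks.simps by simp
    next
      case (Suc s)
      have "walks (2 * s + (g + 2) + 2) (g + 2) 0 + (2 * s + (g + 2) + 2 choose s) =
          (2 * s + (g + 2) + 2 choose Suc s)"
        using h Suc by (intro less) simp
      moreover have "2 * s + (g + 2) + 2 = 2 * r + g + 2"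
        using Suc by simp
      ultimately show ?thesis
        using IH1 unfolding e h walks.simps Suc binomial_Suc_Suc by simp
    qed
  qed
qed

lemma walks_catalan: "real (walks (2 * m) 0 0) = catalan m"
proof (cases m)
  case 0
  then show ?thesis by (simp add: catalan_def)
next
  case (Suc r)
  have "walks (2 * m) 0 0 + (2 * m choose r) = (2 * m choose m)"
    using walks_reflection[of r 0] Suc by simp
  then have "Suc m * walks (2 * m) 0 0 + Suc m * (2 * m choose r) = Suc m * (2 * m choose m)"
    by (simp only: flip: distrib_left)
  \<comment> \<open>Absorption: with \<open>r = m - 1\<close>, both sides equal
    \<open>2 * m - r\<close> times the left binomial.\<close>
  moreover have "Suc m * (2 * m choose r) = m * (2 * m choose m)"
  proof -
    have "(2 * m - r) * (2 * m choose r) = Suc r * (2 * m choose Suc r)"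
      by (simp only: binomial_absorb_comp binomial_absorption)
    moreover have "2 * m - r = Suc m"
      using Suc by simp
    ultimately show ?thesis by (simp only: Suc)
  qed
  ultimately have "Suc m * walks (2 * m) 0 0 = (2 * m choose m)"
    by simp
  then have "real (Suc m) * real (walks (2 * m) 0 0) = real (2 * m choose m)"
    by (simp only: flip: of_nat_mult)
  then show ?thesis
    by (simp add: catalan_def field_simps)
qed

section \<open>Lattice paths\<close>

text \<open>Vertices are always computed from the origin, so the starting altitude \<open>a\<close>
  enters as an offset.\<close>

definition nonneg_paths :: "nat \<Rightarrow> nat \<Rightarrow> nat \<Rightarrow> (int \<times> int) list set" where
  "nonneg_paths n a b = {p. length p = n \<and> set p \<subseteq> {rise, fall} \<and>
     int a + snd (path_vertex p n) = int b \<and> (\<forall>j\<le>n. 0 \<le> int a + snd (path_vertex p j))}"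

lemma path_vertex_0 [simp]: "path_vertex p 0 = (0, 0)"
  by (simp add: path_vertex_def zero_prod_def)

lemma path_vertex_Cons [simp]: "path_vertex (s # p) (Suc j) = s + path_vertex p j"
  by (simp add: path_vertex_def)

text \<open>The abscissa recovers the index: vertices at different indices are distinct, and the
  horizontal part of the endpoint condition is automatic.\<close>

lemma fst_path_vertex:
  "set p \<subseteq> {rise, fall} \<Longrightarrow> j \<le> length p \<Longrightarrow> fst (path_vertex p j) = int j"
proof (induction p arbitrary: j)
  case (Cons s p)
  then show ?case by (cases j) (auto simp: rise_def fall_def)
qed simp

lemma path_vertex_append:
  "path_vertex (p @ q) (length p + j) = path_vertex p (length p) + path_vertex q j"
  by (simp add: path_vertex_def)

lemma finite_nonneg_paths: "finite (nonneg_paths n a b)"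
proof (rule finite_subset)
  show "nonneg_paths n a b \<subseteq> {p. set p \<subseteq> {rise, fall} \<and> length p = n}"
    by (auto simp: nonneg_paths_def)
qed (rule finite_lists_length_eq, simp)

lemma all_le_Suc_conv: "(\<forall>j\<le>Suc n. P j) \<longleftrightarrow> P 0 \<and> (\<forall>j\<le>n. P (Suc j))"
  by (metis Suc_le_mono le0 not0_implies_Suc)

lemma nonneg_paths_Suc_0: "nonneg_paths (Suc n) 0 b = Cons rise ` nonneg_paths n 1 b"
proof -
  have "p \<in> nonneg_paths (Suc n) 0 b \<longleftrightarrow> p \<in> Cons rise ` nonneg_paths n 1 b" for p
    by (cases p)
      (auto simp: nonneg_paths_def all_le_Suc_conv rise_def fall_def image_iff add.assoc)
  then show ?thesis by blast
qed

lemma nonneg_paths_Suc_Suc: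
  "nonneg_paths (Suc n) (Suc a) b =
    Cons rise ` nonneg_paths n (a + 2) b \<union> Cons fall ` nonneg_paths n a b"
proof -
  have "p \<in> nonneg_paths (Suc n) (Suc a) b \<longleftrightarrow>
      p \<in> Cons rise ` nonneg_paths n (a + 2) b \<union> Cons fall ` nonneg_paths n a b" for p
    by (cases p)
      (auto simp: nonneg_paths_def all_le_Suc_conv rise_def fall_def image_iff algebra_simps)
  then show ?thesis by blast
qed

lemma card_nonneg_paths: "card (nonneg_paths n a b) = walks n a b"
proof (induction n a b rule: walks.induct)
  case (1 a b)
  have "nonneg_paths 0 a b = (if a = b then {[]} else {})"
    by (auto simp: nonneg_paths_def)
  then show ?case by simp
next
  case (2 n b)
  then show ?case by (simp add: nonneg_paths_Suc_0 card_image)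
next
  case (3 n a b)
  have "rise \<noteq> fall" by (simp add: rise_def fall_def)
  then have "Cons rise ` nonneg_paths n (a + 2) b \<inter> Cons fall ` nonneg_paths n a b = {}"
    by auto
  with 3 show ?case
    by (simp add: nonneg_paths_Suc_Suc card_Un_disjoint finite_nonneg_paths card_image)
qed

section \<open>Cutting and gluing paths\<close>

lemma append_in_nonneg_paths_iff:
  assumes "length p = m" "length q = n" "int a + snd (path_vertex p m) = int b"
  shows "p @ q \<in> nonneg_paths (m + n) a c \<longleftrightarrow> p \<in> nonneg_paths m a b \<and> q \<in> nonneg_paths n b c"
proof -
  have left: "path_vertex (p @ q) j = path_vertex p j" if "j \<le> m" for j
    using assms that by (simp add: path_vertex_def)
  have right: "path_vertex (p @ q) (m + j) = path_vertex p m + path_vertex q j" for j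
    using assms path_vertex_append[of p q] by simp
  have right': "int a + snd (path_vertex (p @ q) (m + j)) = int b + snd (path_vertex q j)" for j
    using assms(3) by (simp add: right)
  have "(\<forall>j\<le>m + n. 0 \<le> int a + snd (path_vertex (p @ q) j)) \<longleftrightarrow>
      (\<forall>j\<le>m. 0 \<le> int a + snd (path_vertex p j)) \<and> (\<forall>j\<le>n. 0 \<le> int b + snd (path_vertex q j))"
    (is "?L \<longleftrightarrow> ?R1 \<and> ?R2")
  proof (intro iffI conjI)
    assume L: ?L
    show ?R1
    proof (intro allI impI)
      fix j assume "j \<le> m"
      then show "0 \<le> int a + snd (path_vertex p j)"
        using L[rule_format, of j] left by simp
    qed
    show ?R2
      using L right' by (metis add_le_cancel_left)
  next
    assume R: "?R1 \<and> ?R2"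
    show ?L
    proof (intro allI impI)
      fix j assume "j \<le> m + n"
      then show "0 \<le> int a + snd (path_vertex (p @ q) j)"
        using R left[of j] right'[of "j - m"] by (cases "j \<le> m") auto
    qed
  qed
  then show ?thesis
    using assms right'[of n] by (auto simp: nonneg_paths_def)
qed

text \<open>Cutting at index \<open>j\<close> is a bijection onto pairs of nonnegative paths meeting
  at altitude \<open>b\<close>, with concatenation as inverse.\<close>

lemma card_nonneg_paths_through:
  assumes "j \<le> n"
  shows "card {p \<in> nonneg_paths n a c. int a + snd (path_vertex p j) = int b} =
    walks j a b * walks (n - j) b c" (is "card ?A = _")
proof -
  have "bij_betw (\<lambda>(p, q). p @ q) (nonneg_paths j a b \<times> nonneg_paths (n - j) b c) ?A"
  proof (rule bij_betw_byWitness[where f' = "\<lambda>p. (take j p, drop j p)"])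
    show "\<forall>x\<in>nonneg_paths j a b \<times> nonneg_paths (n - j) b c.
        (case case x of (p, q) \<Rightarrow> p @ q of r \<Rightarrow> (take j r, drop j r)) = x"
      by (auto simp: nonneg_paths_def)
    show "(\<lambda>(p, q). p @ q) ` (nonneg_paths j a b \<times> nonneg_paths (n - j) b c) \<subseteq> ?A"
    proof clarsimp
      fix p q assume pq: "p \<in> nonneg_paths j a b" "q \<in> nonneg_paths (n - j) b c"
      then have *: "length p = j" "length q = n - j" "int a + snd (path_vertex p j) = int b"
        by (auto simp: nonneg_paths_def)
      with pq append_in_nonneg_paths_iff[OF *, of c] assms
      show "p @ q \<in> nonneg_paths n a c \<and> int a + snd (path_vertex (p @ q) j) = int b"
        by (simp add: path_vertex_def)
    qed
    show "(\<lambda>p. (take j p, drop j p)) ` ?A \<subseteq> nonneg_paths j a b \<times> nonneg_paths (n - j) b c"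
    proof clarsimp
      fix p assume p: "p \<in> nonneg_paths n a c" "int a + snd (path_vertex p j) = int b"
      have *: "length (take j p) = j" "length (drop j p) = n - j"
        "int a + snd (path_vertex (take j p) j) = int b"
        using p assms by (auto simp: nonneg_paths_def path_vertex_def)
      with p append_in_nonneg_paths_iff[OF *, of c] assms
      show "take j p \<in> nonneg_paths j a b \<and> drop j p \<in> nonneg_paths (n - j) b c"
        by simp
    qed
  qed auto
  from bij_betw_same_card[OF this] show ?thesis
    by (simp add: card_cartesian_product card_nonneg_paths)
qed

section \<open>Dyck paths\<close>

lemma dyck_paths_eq_nonneg_paths: "dyck_paths k = nonneg_paths (2 * k) 0 0"
proof -
  have "(\<forall>v\<in>path_vertices p. 0 \<le> snd v) \<longleftrightarrow> (\<forall>j\<le>length p. 0 \<le> snd (path_vertex p j))" for p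
    unfolding path_vertices_def by blast
  then show ?thesis
    by (auto simp: dyck_paths_def nonneg_paths_def prod_eq_iff fst_path_vertex)
qed

lemma card_dyck_paths: "real (card (dyck_paths k)) = catalan k"
  by (simp only: dyck_paths_eq_nonneg_paths card_nonneg_paths walks_catalan)

lemma vertex_count_eq_card_times:
  assumes "p \<in> dyck_paths k"
  shows "vertex_count i p = card {j \<in> {..2 * k}. snd (path_vertex p j) = int i}"
proof -
  have p: "length p = 2 * k" "set p \<subseteq> {rise, fall}"
    using assms by (auto simp: dyck_paths_def)
  have "inj_on (path_vertex p) {j \<in> {..2 * k}. snd (path_vertex p j) = int i}"
    using p by (intro inj_onI) (metis (mono_tags, lifting) atMost_iff fst_path_vertex
        mem_Collect_eq of_nat_eq_iff)
  moreover have "{v \<in> path_vertices p. snd v = int i} =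
      path_vertex p ` {j \<in> {..2 * k}. snd (path_vertex p j) = int i}"
    using p by (auto simp: path_vertices_def)
  ultimately show ?thesis
    by (simp add: vertex_count_def card_image)
qed

text \<open>Double counting of pairs of a path and an index at which it has altitude
  \<open>i\<close>.\<close>

lemma sum_vertex_count:
  "(\<Sum>p\<in>dyck_paths k. vertex_count i p) = walks (2 * k + 1) (2 * i + 1) 0"
proof -
  have "(\<Sum>p\<in>dyck_paths k. vertex_count i p) =
      (\<Sum>p\<in>dyck_paths k. card {j \<in> {..2 * k}. snd (path_vertex p j) = int i})"
    by (intro sum.cong refl vertex_count_eq_card_times)
  also have "\<dots> = (\<Sum>j\<le>2 * k. card {p \<in> dyck_paths k. snd (path_vertex p j) = int i})"
    by (rule sum_multicount_gen) (auto simp: finite_dyck_paths)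
  \<comment> \<open>The initial piece is reversed, so that both factors run from \<open>i\<close> to
    0 as in \<open>walks_convolution\<close>.\<close>
  also have "\<dots> = (\<Sum>j\<le>2 * k. walks j i 0 * walks (2 * k - j) i 0)"
  proof (rule sum.cong[OF refl])
    fix j assume "j \<in> {..2 * k}"
    then show "card {p \<in> dyck_paths k. snd (path_vertex p j) = int i} =
        walks j i 0 * walks (2 * k - j) i 0"
      using card_nonneg_paths_through[of j "2 * k" 0 0 i] walks_commute[of j 0 i]
      by (simp add: dyck_paths_eq_nonneg_paths)
  qed
  also have "\<dots> = walks (2 * k + 1) (2 * i + 1) 0"
    using walks_convolution[of i "2 * k" i] by (simp add: mult_2 del: walks.simps)
  finally show ?thesis .
qed

lemma expected_vertex_count_eq:
  "expected_vertex_count k i = (\<Sum>p\<in>dyck_paths k. real (vertex_count i p)) / catalan k"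
  unfolding expected_vertex_count_def
  by (subst integral_pmf_of_set)
    (simp_all add: finite_dyck_paths dyck_paths_nonempty card_dyck_paths)

theorem theorem2:
  fixes k :: nat
  assumes "k \<ge> 1"
  shows "(L2_set (expected_vertex_count k) {0..k})\<^sup>2 =
           1 / (catalan k)\<^sup>2 *
             (\<Sum>p1\<in>dyck_paths k. \<Sum>p2\<in>dyck_paths k. \<Sum>i=0..k.
                real (vertex_count i p1) * real (vertex_count i p2))
       \<and> 1 / (catalan k)\<^sup>2 *
             (\<Sum>p1\<in>dyck_paths k. \<Sum>p2\<in>dyck_paths k. \<Sum>i=0..k.
                real (vertex_count i p1) * real (vertex_count i p2)) =
           catalan (2 * k + 1) / (catalan k)\<^sup>2"
proof -
  let ?D = "dyck_paths k"
  let ?S = "\<Sum>p1\<in>?D. \<Sum>p2\<in>?D. \<Sum>i=0..k. real (vertex_count i p1) * real (vertex_count i p2)"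
  \<comment> \<open>With \<open>i\<close> outermost, the sum over pairs of paths becomes a square
    for each altitude.\<close>
  have "?S = (\<Sum>p1\<in>?D. \<Sum>i=0..k. \<Sum>p2\<in>?D. real (vertex_count i p1) * real (vertex_count i p2))"
    by (intro sum.cong refl sum.swap)
  also have "\<dots> = (\<Sum>i=0..k. \<Sum>p1\<in>?D. \<Sum>p2\<in>?D. real (vertex_count i p1) * real (vertex_count i p2))"
    by (rule sum.swap)
  also have "\<dots> = (\<Sum>i=0..k. (\<Sum>p\<in>?D. real (vertex_count i p))\<^sup>2)"
    by (simp add: power2_eq_square sum_product)
  finally have S: "?S = (\<Sum>i=0..k. (\<Sum>p\<in>?D. real (vertex_count i p))\<^sup>2)" .
  have "(L2_set (expected_vertex_count k) {0..k})\<^sup>2 = (\<Sum>i=0..k. (expected_vertex_count k i)\<^sup>2)"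
    by (simp add: L2_set_def sum_nonneg)
  also have "\<dots> = 1 / (catalan k)\<^sup>2 * ?S"
    unfolding S by (simp add: expected_vertex_count_eq power_divide flip: sum_divide_distrib)
  finally have "(L2_set (expected_vertex_count k) {0..k})\<^sup>2 = 1 / (catalan k)\<^sup>2 * ?S" .
  moreover have "?S = catalan (2 * k + 1)"
  proof -
    have "?S = real (\<Sum>i\<le>k. (walks (2 * k + 1) (2 * i + 1) 0)\<^sup>2)"
      unfolding S sum_vertex_count[symmetric] by (simp add: atLeast0AtMost)
    \<comment> \<open>The midpoint count has length \<open>4 * k + 2\<close>, which is twice
      \<open>2 * k + 1\<close>.\<close>
    also have "\<dots> = catalan (2 * k + 1)"
      unfolding sum_walks_odd_squared using walks_catalan[of "2 * k + 1"] by (simp del: walks.simps)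
    finally show ?thesis .
  qed
  ultimately show ?thesis by simp
qed

end
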